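(* The map $F:\mathrm{GT}\to\mathbb{R}^3$ is non-degenerate at every point $(p,q,r)\in \Pi^+\setminus \mathrm{Cyl}$. In particular, the map $F$ is locally bijective on the set $\Pi^+\setminus \mathrm{Cyl}$ and, consequently, $F(\Pi^+\setminus \mathrm{Cyl})$ is an open subset of full measure in the closure $\mathrm{CFT}$ of $F(\mathrm{GT})$.
   Context: Let $\Pi^0=\{(p,q,0)\}\subset\mathbb{R}^3$ and $\Pi^+=\{(p,q,r)\in\mathbb{R}^3\mid r>0\}$. Fix a non-degenerate triangle $ABC$ with $A,B,C\in\Pi^0$. Put $\mathrm{GT}=\Pi^+\cup(\Pi^0\setminus\{A,B,C\})$ and define $F:\mathrm{GT}\to\mathbb{R}^3$ by $F(D)=(\cos\angle BDC,\cos\angle ADC,\cos\angle ADB)$. $F$ is non-degenerate at a point if the gradients of its three components with respect to the Cartesian coordinates $(p,q,r)$ are linearly independent there. $\mathrm{Cyl}=S\times(-\infty,\infty)$ is the right circular cylinder over the circle $S\subset\Pi^0$ circumscribed around $ABC$. $\mathrm{CFT}$ is the closure of $F(\mathrm{GT})$ in $\mathbb{R}^3$. *)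

theory Defs
  imports "HOL-Analysis.Analysis"
begin

definition Pi0 :: "(real^3) set"
  where "Pi0 = {D. D $ 3 = 0}"

definition Pi_plus :: "(real^3) set"
  where "Pi_plus = {D. D $ 3 > 0}"

definition GT :: "real^3 \<Rightarrow> real^3 \<Rightarrow> real^3 \<Rightarrow> (real^3) set"
  where "GT A B C = Pi_plus \<union> (Pi0 - {A, B, C})"

text \<open>The vertex of the angle is the middle argument. The value is only meaningful when
  the vertex differs from both other points, which holds for all uses on \<^const>\<open>GT\<close>.\<close>

definition angle :: "'a::real_inner \<Rightarrow> 'a \<Rightarrow> 'a \<Rightarrow> real"
  where "angle X D Y = arccos (((X - D) \<bullet> (Y - D)) / (norm (X - D) * norm (Y - D)))"

definition cos_map :: "real^3 \<Rightarrow> real^3 \<Rightarrow> real^3 \<Rightarrow> real^3 \<Rightarrow> real^3"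
  where "cos_map A B C D = vector [cos (angle B D C), cos (angle A D C), cos (angle A D B)]"

text \<open>All three components have gradients at \<open>x\<close>, and these are linearly independent as a
  family; injectivity is needed because \<open>range g\<close> alone would forget repetitions.\<close>

definition nondegenerate_at :: "(real^3 \<Rightarrow> real^3) \<Rightarrow> real^3 \<Rightarrow> bool"
  where "nondegenerate_at f x \<longleftrightarrow>
    (\<exists>g :: 3 \<Rightarrow> real^3. (\<forall>i. GDERIV (\<lambda>y. f y $ i) x :> g i) \<and> inj g \<and> independent (range g))"

definition locally_bijective_on :: "('a::topological_space \<Rightarrow> 'b::topological_space) \<Rightarrow> 'a set \<Rightarrow> bool"
  where "locally_bijective_on f X \<longleftrightarrow>
    (\<forall>x\<in>X. \<exists>U V. open U \<and> x \<in> U \<and> U \<subseteq> X \<and> open V \<and> bij_betw f U V)"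

text \<open>For a non-degenerate triangle in \<^const>\<open>Pi0\<close> the circumcentre \<open>Q\<close> below exists and is
  unique, so this is the circle through \<open>A\<close>, \<open>B\<close>, \<open>C\<close> in that plane.\<close>

definition circumcircle :: "real^3 \<Rightarrow> real^3 \<Rightarrow> real^3 \<Rightarrow> (real^3) set"
  where "circumcircle A B C =
    {P \<in> Pi0. \<exists>Q\<in>Pi0. dist Q A = dist Q B \<and> dist Q A = dist Q C \<and> dist Q P = dist Q A}"

definition Cyl :: "real^3 \<Rightarrow> real^3 \<Rightarrow> real^3 \<Rightarrow> (real^3) set"
  where "Cyl A B C = {D. vector [D $ 1, D $ 2, 0] \<in> circumcircle A B C}"

definition CFT :: "real^3 \<Rightarrow> real^3 \<Rightarrow> real^3 \<Rightarrow> (real^3) set"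
  where "CFT A B C = closure (cos_map A B C ` GT A B C)"

end

(* The gradient of a cosine of the angle XDY is a combination of X - D and Y - D, so the Jacobian
   determinant of F factors as det (A - D, B - D, C - D), which is proportional to the height of D
   over the plane, times a cubic danger_poly in D. The cubic terms of the latter cancel, and what
   remains is a nonzero multiple of |P - Q|^2 - R^2, where P is the projection of D, Q the circumcentre
   and R the circumradius. Hence F is regular on the open half-space off the cylinder, and the
   inverse function theorem applies.

   For the measure claim, let D_n in GT with F(D_n) convergent. If D_n is unbounded, all three cosines
   subconverge to 1. If D_n subconverges to a vertex, say A, the cosine of the angle BDC converges to that of
   BAC, so the limit lies in a fixed plane. Otherwise the limit is F(D) with D in GT, and if D is on the
   cylinder or in the plane, it is a critical value, so Sard's theorem applies. *)

theory Submission
  imports Defs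
begin

section \<open>Cosine of an angle: formula, gradient, limit at infinity\<close>

definition cos_at :: "'a::real_inner \<Rightarrow> 'a \<Rightarrow> 'a \<Rightarrow> real"
  where "cos_at X Y D = ((X - D) \<bullet> (Y - D)) / (norm (X - D) * norm (Y - D))"

text \<open>Cauchy-Schwarz puts the quotient in [-1, 1], where \<open>cos\<close> undoes
  \<open>arccos\<close>. At \<open>D = X\<close> or \<open>D = Y\<close> division by zero makes the
  quotient 0, so the identity holds there too.\<close>

lemma cos_angle: "cos (angle X D Y) = cos_at X Y D"
proof -
  have "\<bar>cos_at X Y D\<bar> \<le> 1"
  proof (cases "norm (X - D) * norm (Y - D) = 0")
    case False
    then have "norm (X - D) * norm (Y - D) > 0"
      by (metis mult_nonneg_nonneg norm_ge_zero less_eq_real_def)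
    then show ?thesis
      using Cauchy_Schwarz_ineq2[of "X - D" "Y - D"]
      by (simp add: cos_at_def abs_mult divide_le_eq)
  qed (auto simp: cos_at_def)
  then show ?thesis
    unfolding angle_def cos_at_def by (intro cos_arccos_abs)
qed

lemma cos_map_eq: "cos_map A B C D = vector [cos_at B C D, cos_at A C D, cos_at A B D]"
  by (simp add: cos_map_def cos_angle)

text \<open>With \<open>a = X - D\<close> and \<open>b = Y - D\<close> the numerators are
  \<open>a \<bullet> b - a \<bullet> a\<close> and \<open>a \<bullet> b - b \<bullet> b\<close>.
  Keeping the result as a combination of \<open>a\<close> and \<open>b\<close> lets the Jacobian
  determinant factor later.\<close>

definition grad_cos_at :: "'a::real_inner \<Rightarrow> 'a \<Rightarrow> 'a \<Rightarrow> 'a"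
  where "grad_cos_at X Y D =
    (((X - D) \<bullet> (Y - X)) / (norm (X - D) ^ 3 * norm (Y - D))) *\<^sub>R (X - D)
    + (((Y - D) \<bullet> (X - Y)) / (norm (Y - D) ^ 3 * norm (X - D))) *\<^sub>R (Y - D)"

lemma GDERIV_cos_at:
  fixes X Y D :: "'a::real_inner"
  assumes "D \<noteq> X" "D \<noteq> Y"
  shows "GDERIV (cos_at X Y) D :> grad_cos_at X Y D"
proof -
  define a b where "a = X - D" and "b = Y - D"
  have nz: "norm a \<noteq> 0" "norm b \<noteq> 0"
    using assms by (auto simp: a_def b_def)
  have "((\<lambda>D. norm (Z - D)) has_derivative (\<lambda>h. (0 - h) \<bullet> sgn (Z - D))) (at D)"
    if "Z - D \<noteq> 0" for Z
    using that by (intro has_derivative_compose[OF _ has_derivative_norm] derivative_intros)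
  from this[of X] this[of Y] nz
  have "((\<lambda>D. norm (X - D)) has_derivative (\<lambda>h. (0 - h) \<bullet> sgn a)) (at D)"
    "((\<lambda>D. norm (Y - D)) has_derivative (\<lambda>h. (0 - h) \<bullet> sgn b)) (at D)"
    by (auto simp: a_def b_def)
  from has_derivative_mult[OF this]
  have n: "((\<lambda>D. norm (X - D) * norm (Y - D)) has_derivative
      (\<lambda>h. norm a * ((0 - h) \<bullet> sgn b) + ((0 - h) \<bullet> sgn a) * norm b)) (at D)"
    by (simp add: a_def b_def)
  have i: "((\<lambda>D. (X - D) \<bullet> (Y - D)) has_derivative (\<lambda>h. a \<bullet> (0 - h) + (0 - h) \<bullet> b)) (at D)"
    unfolding a_def b_def by (intro derivative_intros)
  have "((\<lambda>D. ((X - D) \<bullet> (Y - D)) / (norm (X - D) * norm (Y - D))) has_derivative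
     (\<lambda>h. h \<bullet> grad_cos_at X Y D)) (at D)"
  proof (rule has_derivative_eq_rhs[OF has_derivative_divide'[OF i n]])
    have *: "Y - X = b - a" "X - Y = a - b"
      by (simp_all add: a_def b_def)
    have sq: "a \<bullet> a = (norm a)^2" "b \<bullet> b = (norm b)^2"
      by (simp_all add: power2_norm_eq_inner)
    \<comment> \<open>The scalar identity behind the quotient rule, with \<open>p\<close>,
      \<open>q\<close> for \<open>h \<bullet> a\<close>, \<open>h \<bullet> b\<close>,
      \<open>m\<close> for \<open>a \<bullet> b\<close> and \<open>x\<close>, \<open>y\<close> for
      the norms of \<open>a\<close>, \<open>b\<close>.\<close>
    have frac: "(- (p + q) * (x * y) - m * (x * (- q / y) + - p / x * y)) / ((x * y) * (x * y))
        = (m - x\<^sup>2) / (x ^ 3 * y) * p + (m - y\<^sup>2) / (y ^ 3 * x) * q"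
      if "x \<noteq> 0" "y \<noteq> 0" for p q m x y :: real
      using that by (simp add: divide_simps) (simp add: algebra_simps power2_eq_square power3_eq_cube)
    have "((a \<bullet> (0 - h) + (0 - h) \<bullet> b) * (norm a * norm b)
        - (a \<bullet> b) * (norm a * ((0 - h) \<bullet> sgn b) + (0 - h) \<bullet> sgn a * norm b))
        / ((norm a * norm b) * (norm a * norm b)) = h \<bullet> grad_cos_at X Y D" for h
    proof -
      have "a \<bullet> (0 - h) + (0 - h) \<bullet> b = - (h \<bullet> a + h \<bullet> b)"
        "(0 - h) \<bullet> sgn b = - (h \<bullet> b) / norm b" "(0 - h) \<bullet> sgn a = - (h \<bullet> a) / norm a"
        by (simp_all add: inner_commute[of a] sgn_div_norm divide_inverse)
      moreover have "h \<bullet> grad_cos_at X Y D =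
          (a \<bullet> b - (norm a)\<^sup>2) / (norm a ^ 3 * norm b) * (h \<bullet> a)
          + (a \<bullet> b - (norm b)\<^sup>2) / (norm b ^ 3 * norm a) * (h \<bullet> b)"
        unfolding grad_cos_at_def * a_def[symmetric] b_def[symmetric]
        by (simp add: inner_add_right inner_diff_right sq inner_commute[of b a])
      ultimately show ?thesis
        using frac[OF nz] by simp
    qed
    then show "(\<lambda>h. ((a \<bullet> (0 - h) + (0 - h) \<bullet> b) * (norm (X - D) * norm (Y - D))
        - ((X - D) \<bullet> (Y - D)) * (norm a * ((0 - h) \<bullet> sgn b) + (0 - h) \<bullet> sgn a * norm b))
        / ((norm (X - D) * norm (Y - D)) * (norm (X - D) * norm (Y - D))))
      = (\<lambda>h. h \<bullet> grad_cos_at X Y D)"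
      unfolding a_def[symmetric] b_def[symmetric] by blast
  qed (use nz in \<open>simp add: a_def b_def\<close>)
  then show ?thesis
    by (simp add: gderiv_def cos_at_def[abs_def])
qed

text \<open>Let \<open>a = X - D\<close> and \<open>b = Y - D\<close>. By the law of cosines and
  AM-GM, \<open>norm a * norm b - a \<bullet> b\<close> lies between 0 and half the squared length
  of \<open>X - Y\<close>, while the denominator \<open>norm a * norm b\<close> grows without
  bound.\<close>

lemma cos_at_tendsto_1:
  fixes X Y :: "'a::real_inner"
  shows "(cos_at X Y \<longlongrightarrow> 1) at_infinity"
proof -
  have le: "\<bar>cos_at X Y D - 1\<bar> \<le> (norm (X - Y))\<^sup>2 / 2 / t\<^sup>2"
    if "t > 0" "norm D \<ge> norm X + norm Y + t" for D t
  proof -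
    define a b where "a = X - D" and "b = Y - D"
    have ab: "norm a \<ge> t" "norm b \<ge> t"
      using that norm_triangle_ineq2[of D X] norm_triangle_ineq2[of D Y]
        norm_ge_zero[of X] norm_ge_zero[of Y]
      unfolding a_def b_def by (simp_all only: norm_minus_commute[of _ D])
    then have pos: "norm a * norm b > 0"
      using that(1) by (intro mult_pos_pos) linarith+
    have "a \<bullet> b \<le> norm a * norm b"
      by (rule norm_cauchy_schwarz)
    moreover have "2 * (a \<bullet> b) = (norm a)^2 + (norm b)^2 - (norm (X - Y))^2"
      unfolding a_def b_def power2_norm_eq_inner by (simp add: inner_diff inner_commute)
    moreover have "(norm a)^2 + (norm b)^2 \<ge> 2 * (norm a * norm b)"
      using sum_squares_bound[of "norm a" "norm b"] by simp
    ultimately have "\<bar>a \<bullet> b - norm a * norm b\<bar> \<le> (norm (X - Y))\<^sup>2 / 2"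
      by linarith
    moreover have "cos_at X Y D - 1 = (a \<bullet> b - norm a * norm b) / (norm a * norm b)"
      using pos by (auto simp: cos_at_def a_def b_def diff_divide_distrib)
    ultimately have "\<bar>cos_at X Y D - 1\<bar> \<le> (norm (X - Y))\<^sup>2 / 2 / (norm a * norm b)"
      using pos by (simp add: abs_mult divide_right_mono del: divide_divide_eq_left)
    also have "\<dots> \<le> (norm (X - Y))\<^sup>2 / 2 / t\<^sup>2"
      using ab that by (intro divide_left_mono mult_pos_pos) (auto simp: power2_eq_square intro!: mult_mono)
    finally show ?thesis .
  qed
  show ?thesis
  proof (rule Lim_null[THEN iffD2], rule Lim_null_comparison)
    show "\<forall>\<^sub>F D in at_infinity. norm (cos_at X Y D - 1)
        \<le> (norm (X - Y))\<^sup>2 / 2 / (norm D - norm X - norm Y)\<^sup>2"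
      unfolding eventually_at_infinity
      by (intro exI[of _ "norm X + norm Y + 1"] allI impI, unfold real_norm_def, rule le) simp_all
    show "((\<lambda>D::'a. (norm (X - Y))\<^sup>2 / 2 / (norm D - norm X - norm Y)\<^sup>2) \<longlongrightarrow> 0) at_infinity"
    proof -
      have "filterlim (\<lambda>D. (- norm X - norm Y) + norm D) at_top (at_infinity :: 'a filter)"
        by (rule filterlim_tendsto_add_at_top[OF tendsto_const filterlim_norm_at_top])
      then have "filterlim (\<lambda>D. (norm D - norm X - norm Y)\<^sup>2) at_top (at_infinity :: 'a filter)"
        by (intro filterlim_pow_at_top) (auto simp: algebra_simps)
      then show ?thesis
        by (rule real_tendsto_divide_at_top[OF tendsto_const])
    qed
  qed
qed

section \<open>Jacobian matrix of the cosine map\<close>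

lemma vector_3_eq_lambda:
  "(vector [x, y, z] :: 'a::zero^3) = (\<chi> i. if i = 1 then x else if i = 2 then y else z)"
  by (auto simp: vec_eq_iff forall_3)

lemma continuous_on_vector_3 [continuous_intros]:
  fixes f g h :: "_ \<Rightarrow> 'b::{topological_space,zero}"
  assumes "continuous_on S f" "continuous_on S g" "continuous_on S h"
  shows "continuous_on S (\<lambda>x. vector [f x, g x, h x] :: 'b^3)"
  unfolding vector_3_eq_lambda
proof (rule continuous_on_vec_lambda)
  show "continuous_on S (\<lambda>x. if i = 1 then f x else if i = 2 then g x else h x)" for i :: 3
    using assms by (cases "i = 1"; cases "i = 2") simp_all
qed

definition cos_map_jacobian :: "real^3 \<Rightarrow> real^3 \<Rightarrow> real^3 \<Rightarrow> real^3 \<Rightarrow> real^3^3"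
  where "cos_map_jacobian A B C D =
    vector [grad_cos_at B C D, grad_cos_at A C D, grad_cos_at A B D]"

lemma GDERIV_cos_map:
  assumes "D \<notin> {A, B, C}"
  shows "GDERIV (\<lambda>D. cos_map A B C D $ i) D :> cos_map_jacobian A B C D $ i"
  using exhaust_3[of i] assms GDERIV_cos_at
  by (auto simp: cos_map_eq cos_map_jacobian_def)

lemma has_derivative_cos_map:
  assumes "D \<notin> {A, B, C}"
  shows "(cos_map A B C has_derivative (*v) (cos_map_jacobian A B C D)) (at D)"
  apply (subst has_derivative_componentwise_within)
  using GDERIV_cos_map[OF assms]
  by (auto simp: Basis_vec_def gderiv_def inner_axis' matrix_vector_mul_component inner_commute)

lemma continuous_on_grad_cos_at:
  "X \<notin> S \<Longrightarrow> Y \<notin> S \<Longrightarrow> continuous_on S (grad_cos_at X Y)"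
  unfolding grad_cos_at_def[abs_def] by (intro continuous_intros) auto

lemma continuous_on_jacobian:
  "continuous_on (- {A, B, C}) (cos_map_jacobian A B C)"
  unfolding cos_map_jacobian_def[abs_def]
  by (intro continuous_intros continuous_on_grad_cos_at) auto

section \<open>Factorisation of the Jacobian determinant and the cylinder\<close>

definition danger_poly :: "'a::real_inner \<Rightarrow> 'a \<Rightarrow> 'a \<Rightarrow> 'a \<Rightarrow> real"
  where "danger_poly A B C D =
    ((B - D) \<bullet> (C - B)) * ((C - D) \<bullet> (A - C)) * ((A - D) \<bullet> (B - A)) +
    ((C - D) \<bullet> (B - C)) * ((A - D) \<bullet> (C - A)) * ((B - D) \<bullet> (A - B))"

text \<open>Each gradient omits one vertex, so the Jacobian is a coefficient matrix with zero
  diagonal times the matrix with rows \<open>A - D\<close>, \<open>B - D\<close>,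
  \<open>C - D\<close>. Only the two 3-cycles contribute to the determinant of the former; their
  numerators sum to \<open>danger_poly\<close> over a common denominator.\<close>

lemma det_jacobian:
  "det (cos_map_jacobian A B C D) =
     danger_poly A B C D * det (vector [A - D, B - D, C - D] :: real^3^3)
       / (norm (A - D) * norm (B - D) * norm (C - D)) ^ 4"
proof -
  have lin: "det (vector [p *\<^sub>R b + q *\<^sub>R c, r *\<^sub>R a + s *\<^sub>R c, t *\<^sub>R a + u *\<^sub>R b] :: real^3^3)
    = (p * s * t + q * r * u) * det (vector [a, b, c] :: real^3^3)" for a b c :: "real^3" and p q r s t u
    by (simp add: det_3 algebra_simps)
  show ?thesis
    unfolding cos_map_jacobian_def grad_cos_at_def lin danger_poly_def
    by (simp add: distrib_left distrib_right add_divide_distrib power_mult_distrib power4_eq_xxxx power3_eq_cube mult_ac)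
qed

text \<open>Twice the signed area of the triangle projected to the first two coordinates.\<close>

abbreviation signed_area :: "real^3 \<Rightarrow> real^3 \<Rightarrow> real^3 \<Rightarrow> real"
  where "signed_area A B C \<equiv>
    (B $ 1 - A $ 1) * (C $ 2 - A $ 2) - (B $ 2 - A $ 2) * (C $ 1 - A $ 1)"

lemma signed_area_nonzero:
  assumes "A \<in> Pi0" "B \<in> Pi0" "C \<in> Pi0" "\<not> collinear {A, B, C}"
  shows "signed_area A B C \<noteq> 0"
proof
  assume 0: "signed_area A B C = 0"
  have z: "A $ 3 = 0" "B $ 3 = 0" "C $ 3 = 0"
    using assms by (auto simp: Pi0_def)
  \<comment> \<open>\<open>collinear_3\<close> translates by the middle point, so \<open>A\<close>
    is moved there.\<close>
  have "\<not> collinear {B, A, C}"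
    using assms by (simp add: insert_commute)
  then have nc: "\<not> collinear {0, B - A, C - A}"
    by (subst (asm) collinear_3) simp
  then have "B - A \<noteq> 0" and *: "\<nexists>c. C - A = c *\<^sub>R (B - A)"
    by (auto simp: collinear_lemma)
  then consider "B $ 1 \<noteq> A $ 1" | "B $ 2 \<noteq> A $ 2"
    using z by (auto simp: vec_eq_iff forall_3)
  then show False
  proof cases
    case 1
    with 0 z have "C - A = ((C $ 1 - A $ 1) / (B $ 1 - A $ 1)) *\<^sub>R (B - A)"
      by (simp add: vec_eq_iff forall_3) (simp add: field_simps)
    with * show False by blast
  next
    case 2
    with 0 z have "C - A = ((C $ 2 - A $ 2) / (B $ 2 - A $ 2)) *\<^sub>R (B - A)"
      by (simp add: vec_eq_iff forall_3) (simp add: field_simps)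
    with * show False by blast
  qed
qed

text \<open>Six times a signed volume of the tetrahedron \<open>ABCD\<close>, computed on the right
  from base and height.\<close>

lemma det_vertices:
  assumes "A \<in> Pi0" "B \<in> Pi0" "C \<in> Pi0"
  shows "det (vector [A - D, B - D, C - D] :: real^3^3) = - (D $ 3) * signed_area A B C"
  using assms by (simp add: Pi0_def det_3 algebra_simps)

lemma dist_eq_iff_sqdist_3:
  fixes P :: "real^3"
  shows "dist P Q = dist P R \<longleftrightarrow>
    (P $ 1 - Q $ 1)\<^sup>2 + (P $ 2 - Q $ 2)\<^sup>2 + (P $ 3 - Q $ 3)\<^sup>2 =
    (P $ 1 - R $ 1)\<^sup>2 + (P $ 2 - R $ 2)\<^sup>2 + (P $ 3 - R $ 3)\<^sup>2"
  by (simp add: dist_norm norm_eq inner_vec_def sum_3 power2_eq_square)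

text \<open>The last factor is the power of the projection of \<open>D\<close> with respect to the
  circumcircle; it vanishes exactly on the cylinder.\<close>

lemma danger_poly_coords:
  fixes A B C D :: "real^3"
  assumes "A \<in> Pi0" "B \<in> Pi0" "C \<in> Pi0" "Q \<in> Pi0" "dist Q A = dist Q B" "dist Q A = dist Q C"
  shows "danger_poly A B C D = (signed_area A B C)\<^sup>2 *
    ((Q $ 1 - D $ 1)\<^sup>2 + (Q $ 2 - D $ 2)\<^sup>2 - (Q $ 1 - A $ 1)\<^sup>2 - (Q $ 2 - A $ 2)\<^sup>2)"
proof -
  have alg: "((b1 - d1) * (c1 - b1) + (b2 - d2) * (c2 - b2)) * ((c1 - d1) * (a1 - c1) + (c2 - d2) * (a2 - c2))
       * ((a1 - d1) * (b1 - a1) + (a2 - d2) * (b2 - a2))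
     + ((c1 - d1) * (b1 - c1) + (c2 - d2) * (b2 - c2)) * ((a1 - d1) * (c1 - a1) + (a2 - d2) * (c2 - a2))
       * ((b1 - d1) * (a1 - b1) + (b2 - d2) * (a2 - b2))
     = ((b1 - a1) * (c2 - a2) - (b2 - a2) * (c1 - a1))^2 * (d1^2 + d2^2 - a1^2 - a2^2)"
    if "a1^2 + a2^2 = b1^2 + b2^2" "a1^2 + a2^2 = c1^2 + c2^2" for a1 a2 b1 b2 c1 c2 d1 d2 :: real
  proof -
    \<comment> \<open>With the circumcentre at the origin, the edge \<open>e1 = c - b\<close> satisfies
      \<open>b \<bullet> e1 = - l1\<close> and \<open>c \<bullet> e1 = l1\<close>, and cyclically.\<close>
    define l1 l2 l3 where "l1 = ((c1 - b1)^2 + (c2 - b2)^2) / 2"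
      and "l2 = ((a1 - c1)^2 + (a2 - c2)^2) / 2" and "l3 = ((b1 - a1)^2 + (b2 - a2)^2) / 2"
    define k where "k = (b1 - a1) * (c2 - a2) - (b2 - a2) * (c1 - a1)"
    define p1 p2 p3 where "p1 = (\<lambda>x y. x * (c1 - b1) + y * (c2 - b2))"
      and "p2 = (\<lambda>x y. x * (a1 - c1) + y * (a2 - c2))" and "p3 = (\<lambda>x y. x * (b1 - a1) + y * (b2 - a2))"
    \<comment> \<open>The edge vectors satisfy \<open>e1 + e2 + e3 = 0\<close>. Hence both sides
      equal minus the squared length of \<open>p2 e3 - p3 e2\<close>, which is, up to sign,
      \<open>k\<close> times the vector \<open>(x, y)\<close> turned by a right angle.\<close>
    have quad: "2 * (l1 * (p2 x y * p3 x y) + l2 * (p1 x y * p3 x y) + l3 * (p1 x y * p2 x y)) = - (k^2) * (x^2 + y^2)" for x y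
    proof -
      define r s t u where "r = b1 - a1" and "s = b2 - a2" and "t = c1 - a1" and "u = c2 - a2"
      have e: "b1 - a1 = r" "b2 - a2 = s" "c1 - a1 = t" "c2 - a2 = u"
        "a1 - c1 = - t" "a2 - c2 = - u" "c1 - b1 = t - r" "c2 - b2 = u - s"
        by (simp_all add: r_def s_def t_def u_def)
      show ?thesis
        unfolding l1_def l2_def l3_def p1_def p2_def p3_def k_def e
        by (simp add: field_simps power2_eq_square)
    qed
    \<comment> \<open>Evaluating \<open>quad\<close> at the vertex \<open>a\<close> determines the constant term.\<close>
    have a: "p3 a1 a2 = - l3" "p2 a1 a2 = l2" "p1 a1 a2 = l3 - l2"
      using that unfolding l1_def l2_def l3_def p1_def p2_def p3_def
      by (simp_all add: field_simps power2_eq_square)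
    have R: "k^2 * (a1^2 + a2^2) = 2 * l1 * l2 * l3"
      using quad[of a1 a2] unfolding a by (simp add: algebra_simps)
    have f: "(b1 - d1) * (c1 - b1) + (b2 - d2) * (c2 - b2) = - l1 - p1 d1 d2"
      "(c1 - d1) * (a1 - c1) + (c2 - d2) * (a2 - c2) = - l2 - p2 d1 d2"
      "(a1 - d1) * (b1 - a1) + (a2 - d2) * (b2 - a2) = - l3 - p3 d1 d2"
      "(c1 - d1) * (b1 - c1) + (c2 - d2) * (b2 - c2) = - l1 + p1 d1 d2"
      "(a1 - d1) * (c1 - a1) + (a2 - d2) * (c2 - a2) = - l2 + p2 d1 d2"
      "(b1 - d1) * (a1 - b1) + (b2 - d2) * (a2 - b2) = - l3 + p3 d1 d2"
      using that unfolding l1_def l2_def l3_def p1_def p2_def p3_def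
      by (simp_all add: field_simps power2_eq_square)
    \<comment> \<open>Terms of odd degree in the \<open>p\<close>s cancel between the two triple
      products; \<open>quad\<close> evaluates the quadratic part and \<open>R\<close> the constant
      one.\<close>
    show ?thesis
      unfolding f k_def[symmetric] using R quad[of d1 d2] by (simp add: algebra_simps)
  qed
  show ?thesis
    using alg[of "A$1 - Q$1" "A$2 - Q$2" "B$1 - Q$1" "B$2 - Q$2" "C$1 - Q$1" "C$2 - Q$2" "D$1 - Q$1" "D$2 - Q$2"] assms
    by (simp add: danger_poly_def inner_vec_def sum_3 dist_eq_iff_sqdist_3 Pi0_def power2_commute)
qed

text \<open>Equating squared distances cancels the quadratic terms and leaves two linear equations
  for the centre, solved by Cramer's rule with a determinant proportional to the area.\<close>

lemma circumcentre_exists: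
  fixes A B C :: "real^3"
  assumes "A \<in> Pi0" "B \<in> Pi0" "C \<in> Pi0" "signed_area A B C \<noteq> 0"
  obtains Q where "Q \<in> Pi0" "dist Q A = dist Q B" "dist Q A = dist Q C"
proof -
  define k where "k = 2 * signed_area A B C"
  define u where "u = (B$1)\<^sup>2 + (B$2)\<^sup>2 - (A$1)\<^sup>2 - (A$2)\<^sup>2"
  define v where "v = (C$1)\<^sup>2 + (C$2)\<^sup>2 - (A$1)\<^sup>2 - (A$2)\<^sup>2"
  define x where "x = (u * (C$2 - A$2) - v * (B$2 - A$2)) / k"
  define y where "y = (v * (B$1 - A$1) - u * (C$1 - A$1)) / k"
  have k: "k \<noteq> 0" using assms by (simp add: k_def)
  have xk: "x * k = u * (C$2 - A$2) - v * (B$2 - A$2)" and yk: "y * k = v * (B$1 - A$1) - u * (C$1 - A$1)"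
    using k by (simp_all add: x_def y_def)
  have "k * (2 * x * (B$1 - A$1) + 2 * y * (B$2 - A$2)) = k * u"
    using xk yk k_def by algebra
  then have 1: "2 * x * (B$1 - A$1) + 2 * y * (B$2 - A$2) = u" using k by simp
  have "k * (2 * x * (C$1 - A$1) + 2 * y * (C$2 - A$2)) = k * v"
    using xk yk k_def by algebra
  then have 2: "2 * x * (C$1 - A$1) + 2 * y * (C$2 - A$2) = v" using k by simp
  show ?thesis
  proof
    show "vector [x, y, 0] \<in> Pi0" by (simp add: Pi0_def)
    show "dist (vector [x, y, 0]) A = dist (vector [x, y, 0]) B"
         "dist (vector [x, y, 0]) A = dist (vector [x, y, 0]) C"
      using 1 2 assms(1-3)
      by (simp_all add: dist_eq_iff_sqdist_3 Pi0_def u_def v_def power2_eq_square algebra_simps)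
  qed
qed

text \<open>Every circumcentre \<open>Q\<close> gives the same condition by
  \<open>danger_poly_coords\<close>, so the existential quantifier in the circumcircle is settled by
  exhibiting one.\<close>

lemma Cyl_iff:
  assumes "A \<in> Pi0" "B \<in> Pi0" "C \<in> Pi0" "\<not> collinear {A, B, C}"
  shows "D \<in> Cyl A B C \<longleftrightarrow> danger_poly A B C D = 0"
proof -
  note area = signed_area_nonzero[OF assms]
  have "danger_poly A B C D = 0 \<longleftrightarrow> dist Q (vector [D $ 1, D $ 2, 0]) = dist Q A"
    if "Q \<in> Pi0" "dist Q A = dist Q B" "dist Q A = dist Q C" for Q
    using danger_poly_coords[OF assms(1-3) that] area that assms(1)
    by (auto simp: dist_eq_iff_sqdist_3 Pi0_def)
  moreover have "D \<in> Cyl A B C \<longleftrightarrow> (\<exists>Q\<in>Pi0. dist Q A = dist Q B \<and> dist Q A = dist Q C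
      \<and> dist Q (vector [D $ 1, D $ 2, 0]) = dist Q A)"
    by (simp add: Cyl_def circumcircle_def Pi0_def)
  moreover obtain Q where "Q \<in> Pi0" "dist Q A = dist Q B" "dist Q A = dist Q C"
    using circumcentre_exists[OF assms(1-3) area] .
  ultimately show ?thesis
    by metis
qed

section \<open>Local bijectivity and independence of gradients\<close>

lemma locally_bijective_onI:
  fixes f :: "real^'n \<Rightarrow> real^'n"
  assumes "open S"
    and der: "\<And>x. x \<in> S \<Longrightarrow> (f has_derivative (*v) (J x)) (at x)"
    and cont: "continuous_on S J"
    and det: "\<And>x. x \<in> S \<Longrightarrow> det (J x) \<noteq> 0"
  shows "locally_bijective_on f S"
  unfolding locally_bijective_on_def
proof
  fix x assume x: "x \<in> S"
  \<comment> \<open>The inverse function theorem takes the derivative as a continuous family of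
    bounded linear maps, hence the passage from matrices to \<open>blinfun\<close>.\<close>
  define J' where "J' y = Blinfun ((*v) (J y))" for y
  have J': "blinfun_apply (J' y) = (*v) (J y)" for y
    unfolding J'_def by (rule bounded_linear_Blinfun_apply) simp
  have contJ': "continuous_on S J'"
    by (rule continuous_on_blinfun_componentwise)
      (auto simp: J' matrix_vector_mult_def intro!: continuous_intros cont)
  obtain K where K: "K ** J x = mat 1"
    using det[OF x] invertible_det_nz invertible_left_inverse by blast
  have inv: "Blinfun ((*v) K) o\<^sub>L J' x = id_blinfun"
    by (rule blinfun_eqI)
      (simp add: J' bounded_linear_Blinfun_apply matrix_vector_mul_assoc K)
  obtain U V g where "open U" "U \<subseteq> S" "x \<in> U" "open V" "homeomorphism U V f g"
    by (rule inverse_function_theorem[OF \<open>open S\<close> _ contJ' x inv]) (use der J' in auto)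
  moreover from this have "bij_betw f U V"
    by (metis bij_betw_def homeomorphism_def inj_on_inverseI)
  ultimately show "\<exists>U V. open U \<and> x \<in> U \<and> U \<subseteq> S \<and> open V \<and> bij_betw f U V"
    by blast
qed

lemma locally_bijective_on_open_image:
  assumes "locally_bijective_on f S"
  shows "open (f ` S)"
proof (subst open_subopen, clarify)
  fix x assume "x \<in> S"
  then obtain U V where "open V" "x \<in> U" "U \<subseteq> S" "f ` U = V"
    using assms unfolding locally_bijective_on_def bij_betw_def by metis
  then show "\<exists>T. open T \<and> f x \<in> T \<and> T \<subseteq> f ` S"
    by blast
qed

text \<open>Supplies both conditions on the gradients in \<open>nondegenerate_at\<close>: repeated
  or dependent rows would force the determinant to vanish.\<close>

lemma independent_rows_if_det_nonzero:
  fixes M :: "real^'n^'n"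
  assumes "det M \<noteq> 0"
  shows "inj (($) M)" "independent (range (($) M))"
proof -
  have inj: "inj (($) M)"
  proof (rule injI, rule ccontr)
    fix i j assume "M $ i = M $ j" "i \<noteq> j"
    then show False
      using det_identical_rows[of i j M] assms by (simp add: row_def vec_lambda_eta)
  qed
  then show "inj (($) M)" .
  have "rows M = range (($) M)"
    by (auto simp: rows_def row_def vec_lambda_eta)
  then show "independent (range (($) M))"
    using det_dependent_rows[of M] assms
    unfolding scalar_mult_eq_scaleR dependent_raw_def by auto
qed


section \<open>Limit points of the image\<close>

text \<open>Limit points outside the image can only arise from \<open>D\<close> escaping to infinity
  or tending to a vertex. Each case fixes one coordinate, which confines them to four
  planes.\<close>

lemma CFT_subset:
  assumes "A \<noteq> B" "A \<noteq> C" "B \<noteq> C" "A \<in> Pi0" "B \<in> Pi0" "C \<in> Pi0"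
  shows "CFT A B C \<subseteq> cos_map A B C ` GT A B C
    \<union> {p. p $ 1 = 1} \<union> {p. p $ 1 = cos_at B C A} \<union> {p. p $ 2 = cos_at A C B} \<union> {p. p $ 3 = cos_at A B C}"
proof
  let ?F = "cos_map A B C"
  fix p assume "p \<in> CFT A B C"
  then obtain q where q: "\<And>n. q n \<in> ?F ` GT A B C" "q \<longlonglongrightarrow> p"
    unfolding CFT_def closure_sequential by blast
  then obtain D where D: "\<And>n. D n \<in> GT A B C" "\<And>n. q n = ?F (D n)"
    unfolding image_iff Bex_def by metis
  have lim: "(\<lambda>n. ?F (D n)) \<longlonglongrightarrow> p"
    using q(2) by (simp add: D(2)[abs_def] flip: fun_eq_iff)
  show "p \<in> ?F ` GT A B C
    \<union> {p. p $ 1 = 1} \<union> {p. p $ 1 = cos_at B C A} \<union> {p. p $ 2 = cos_at A C B} \<union> {p. p $ 3 = cos_at A B C}"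
  proof (cases "p $ 1 = 1")
    case False
    \<comment> \<open>Half the gap between \<open>p $ 1\<close> and 1: no value is within
      \<open>e\<close> of both, which bounds \<open>D n\<close> for
      \<open>n \<ge> N\<close>.\<close>
    define e where "e = dist (p $ 1) 1 / 2"
    have e: "e > 0" using False by (simp add: e_def)
    have "(\<lambda>n. cos_at B C (D n)) \<longlonglongrightarrow> p $ 1"
      using tendsto_vec_nth[OF lim, of 1] by (simp add: cos_map_eq)
    then have "\<forall>\<^sub>F n in sequentially. dist (cos_at B C (D n)) (p $ 1) < e"
      using e by (rule tendstoD)
    then obtain N where N: "\<And>n. n \<ge> N \<Longrightarrow> dist (cos_at B C (D n)) (p $ 1) < e"
      unfolding eventually_sequentially by blast
    have "\<forall>\<^sub>F P in at_infinity. dist (cos_at B C P) 1 < e"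
      using cos_at_tendsto_1 e by (rule tendstoD)
    then obtain b where b: "\<And>P. norm P \<ge> b \<Longrightarrow> dist (cos_at B C P) 1 < e"
      unfolding eventually_at_infinity by blast
    have bd: "norm (D n) < b" if "n \<ge> N" for n
    proof (rule ccontr)
      assume "\<not> norm (D n) < b"
      then show False
        using N[OF that] b[of "D n"] dist_triangle2[of "p $ 1" 1 "cos_at B C (D n)"]
        by (auto simp: e_def dist_commute)
    qed
    then have "\<forall>n. D (n + N) \<in> cball 0 b"
      by (auto simp: less_imp_le)
    then obtain L r where r: "strict_mono (r :: nat \<Rightarrow> nat)" and "((\<lambda>n. D (n + N)) \<circ> r) \<longlonglongrightarrow> L"
      using compact_cball[of 0 b] unfolding compact_def by metis
    then have L: "(\<lambda>n. D (r n + N)) \<longlonglongrightarrow> L"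
      by (simp add: o_def)
    have "filterlim (\<lambda>n. r n + N) sequentially sequentially"
      using filterlim_subseq[OF r] by (rule filterlim_at_top_mono) auto
    then have lim': "(\<lambda>n. ?F (D (r n + N))) \<longlonglongrightarrow> p"
      by (rule filterlim_compose[OF lim])
    \<comment> \<open>Only the two endpoints of the angle must differ from \<open>L\<close>, so when
      \<open>L\<close> is a vertex this still applies to the angle between the other two.\<close>
    have cont: "cos_at X Y L = l"
      if "L \<noteq> X" "L \<noteq> Y" "(\<lambda>n. cos_at X Y (D (r n + N))) \<longlonglongrightarrow> l" for X Y l
    proof -
      have "isCont (cos_at X Y) L"
        using GDERIV_cos_at[OF that(1,2)] unfolding gderiv_def by (rule has_derivative_continuous)
      then show ?thesis
        using LIMSEQ_unique that(3) isCont_tendsto_compose[OF _ L] by blast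
    qed
    have c: "(\<lambda>n. cos_at B C (D (r n + N))) \<longlonglongrightarrow> p $ 1"
      "(\<lambda>n. cos_at A C (D (r n + N))) \<longlonglongrightarrow> p $ 2"
      "(\<lambda>n. cos_at A B (D (r n + N))) \<longlonglongrightarrow> p $ 3"
      using tendsto_vec_nth[OF lim', of 1] tendsto_vec_nth[OF lim', of 2]
        tendsto_vec_nth[OF lim', of 3] by (simp_all add: cos_map_eq)
    consider "L = A" | "L = B" | "L = C" | "L \<notin> {A, B, C}" by blast
    then show ?thesis
    proof cases
      case 4
      have nonneg: "D n $ 3 \<ge> 0" for n
        using D(1)[of n] by (auto simp: GT_def Pi_plus_def Pi0_def)
      have "L $ 3 \<ge> 0"
        by (rule LIMSEQ_le_const[OF tendsto_vec_nth[OF L]])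
          (use nonneg in blast)
      then have "L \<in> GT A B C"
        using 4 by (auto simp: GT_def Pi_plus_def Pi0_def)
      moreover have "?F L = p"
        using 4 cont[OF _ _ c(1)] cont[OF _ _ c(2)] cont[OF _ _ c(3)]
        by (auto simp: cos_map_eq vec_eq_iff forall_3)
      ultimately show ?thesis by blast
    qed (use assms cont[OF _ _ c(1)] cont[OF _ _ c(2)] cont[OF _ _ c(3)] in auto)
  qed auto
qed

lemma negligible_component: "negligible {p :: real^'n. p $ i = c}"
  using negligible_hyperplane[of "axis i 1 :: real^'n" c] by (simp add: inner_axis' axis_eq_0_iff)

theorem theorem2:
  fixes A B C :: "real^3"
  assumes "A \<in> Pi0" and "B \<in> Pi0" and "C \<in> Pi0"
    and "\<not> collinear {A, B, C}"
  shows "(\<forall>D \<in> Pi_plus - Cyl A B C. nondegenerate_at (cos_map A B C) D)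
    \<and> locally_bijective_on (cos_map A B C) (Pi_plus - Cyl A B C)
    \<and> cos_map A B C ` (Pi_plus - Cyl A B C) \<subseteq> CFT A B C
    \<and> open (cos_map A B C ` (Pi_plus - Cyl A B C))
    \<and> CFT A B C - cos_map A B C ` (Pi_plus - Cyl A B C) \<in> null_sets lebesgue"
proof -
  let ?F = "cos_map A B C" and ?J = "cos_map_jacobian A B C" and ?S = "Pi_plus - Cyl A B C"
  note area = signed_area_nonzero[OF assms]
  have ne: "A \<noteq> B" "A \<noteq> C" "B \<noteq> C"
    using area by auto
  \<comment> \<open>Excluding the vertices keeps the denominator in \<open>det_jacobian\<close>
    nonzero.\<close>
  have det_iff: "det (?J D) = 0 \<longleftrightarrow> D \<in> Cyl A B C \<or> D $ 3 = 0" if "D \<notin> {A, B, C}" for D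
    using that area by (auto simp: det_jacobian det_vertices[OF assms(1-3)] Cyl_iff[OF assms])
  have vertices: "D \<notin> {A, B, C}" if "D \<in> Pi_plus" for D
    using that assms(1-3) by (auto simp: Pi_plus_def Pi0_def)
  have det: "det (?J D) \<noteq> 0" if "D \<in> ?S" for D
    using that vertices[of D] det_iff[of D] by (auto simp: Pi_plus_def)
  have "nondegenerate_at ?F D" if "D \<in> ?S" for D
    unfolding nondegenerate_at_def
    using independent_rows_if_det_nonzero[OF det[OF that]] GDERIV_cos_map[of D A B C] vertices[of D] that
    by (intro exI[of _ "($) (?J D)"]) blast
  moreover have S: "?S = {D. D $ 3 > 0} \<inter> {D. danger_poly A B C D \<noteq> 0}"
    using Cyl_iff[OF assms] by (auto simp: Pi_plus_def)
  have "open ?S"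
    unfolding S danger_poly_def
    by (intro open_Int open_Collect_less open_Collect_neq continuous_intros)
  then have loc: "locally_bijective_on ?F ?S"
    by (rule locally_bijective_onI[where J = ?J])
      (use vertices det in \<open>auto intro!: has_derivative_cos_map
         continuous_on_subset[OF continuous_on_jacobian]\<close>)
  moreover have "?F ` ?S \<subseteq> CFT A B C"
    unfolding CFT_def by (rule order_trans[OF _ closure_subset]) (auto simp: GT_def)
  moreover have "CFT A B C - ?F ` ?S \<in> null_sets lebesgue"
  proof -
    \<comment> \<open>Critical points in all of space off the vertices, including those below the
      plane; Sard's theorem covers this larger set at once.\<close>
    let ?N = "{D. D \<notin> {A, B, C} \<and> det (?J D) = 0}"
    have "negligible (?F ` ?N)"
    proof (rule baby_Sard[where f' = "\<lambda>D. (*v) (?J D)"])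
      show "(?F has_derivative (*v) (?J D)) (at D within ?N)" if "D \<in> ?N" for D
        using that has_derivative_cos_map has_derivative_at_withinI by blast
      show "rank (matrix ((*v) (?J D))) < CARD(3)" if "D \<in> ?N" for D
        using that using det_eq_0_rank[of "?J D"] by auto
    qed simp
    then have "negligible (?F ` ?N \<union> {p. p $ 1 = 1} \<union> {p. p $ 1 = cos_at B C A}
        \<union> {p. p $ 2 = cos_at A C B} \<union> {p. p $ 3 = cos_at A B C})"
      by (intro negligible_Un negligible_component)
    \<comment> \<open>Points of \<open>GT\<close> outside \<open>?S\<close> lie in the plane or on
      the cylinder, so \<open>det_iff\<close> makes them critical.\<close>
    moreover have "?F ` GT A B C \<subseteq> ?F ` ?S \<union> ?F ` ?N"
      using det_iff vertices by (auto simp: GT_def Pi0_def)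
    ultimately show ?thesis
      using CFT_subset[OF ne assms(1-3)] unfolding negligible_iff_null_sets[symmetric]
      by (elim negligible_subset) blast
  qed
  ultimately show ?thesis
    using locally_bijective_on_open_image by blast
qed

end
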